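(* Let $l\geq 1$, $n\geq 2$ and $k\geq 3$ be integers and let $G=B_l(n,k)$. Then $G$ has an equitable $\omega(G)$-coloring.
   Context: A clique is a maximal complete subgraph; $\omega(G)$ is the size of a largest clique. A simplicial vertex is a vertex belonging to exactly one clique of the graph. The graphs $B_l(n,k)$ are defined recursively: $B_1(n,k)$ is the complete graph $K_n$; for $l\geq 2$, $B_l(n,k)$ is obtained from $B_{l-1}(n,k)$ by attaching, to each simplicial vertex $u$ of $B_{l-1}(n,k)$, $k-1$ new cliques of size $n$, each consisting of $u$ together with $n-1$ new vertices (all new vertices distinct). An equitable $t$-coloring is a proper vertex coloring with colors $\{1,\dots,t\}$ in which every color class has size $\lfloor |V(G)|/t\rfloor$ or $\lceil |V(G)|/t\rceil$. *)

theory Defs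
  imports Complex_Main
begin

text \<open>Simple undirected graphs; an edge is the two-element set of its end points.\<close>

record 'a graph =
  verts :: "'a set"
  edges :: "'a set set"

definition complete_edges :: "'a set \<Rightarrow> 'a set set" where
  "complete_edges S = {{x, y} | x y. x \<in> S \<and> y \<in> S \<and> x \<noteq> y}"

definition complete_graph :: "'a set \<Rightarrow> 'a graph" where
  "complete_graph S = \<lparr>verts = S, edges = complete_edges S\<rparr>"

text \<open>Complete subgraphs are identified with their vertex sets.\<close>

definition complete_in :: "'a graph \<Rightarrow> 'a set \<Rightarrow> bool" where
  "complete_in G S \<longleftrightarrow> S \<subseteq> verts G \<and> complete_edges S \<subseteq> edges G"

definition clique :: "'a graph \<Rightarrow> 'a set \<Rightarrow> bool" where
  "clique G C \<longleftrightarrow> complete_in G C \<and> (\<forall>S. complete_in G S \<and> C \<subseteq> S \<longrightarrow> S = C)"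

definition clique_number :: "'a graph \<Rightarrow> nat" where
  "clique_number G = Max {card C | C. clique G C}"

definition simplicial :: "'a graph \<Rightarrow> 'a \<Rightarrow> bool" where
  "simplicial G v \<longleftrightarrow> v \<in> verts G \<and> (\<exists>!C. clique G C \<and> v \<in> C)"

definition proper_coloring :: "'a graph \<Rightarrow> nat \<Rightarrow> ('a \<Rightarrow> nat) \<Rightarrow> bool" where
  "proper_coloring G t c \<longleftrightarrow>
     c ` verts G \<subseteq> {1..t} \<and> (\<forall>x y. {x, y} \<in> edges G \<longrightarrow> c x \<noteq> c y)"

definition equitable_coloring :: "'a graph \<Rightarrow> nat \<Rightarrow> ('a \<Rightarrow> nat) \<Rightarrow> bool" where
  "equitable_coloring G t c \<longleftrightarrow> proper_coloring G t c \<and>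
     (\<forall>i\<in>{1..t}. int (card {v \<in> verts G. c v = i})
        \<in> {\<lfloor>real (card (verts G)) / real t\<rfloor>, \<lceil>real (card (verts G)) / real t\<rceil>})"

text \<open>
  \<^term>\<open>New l u j i\<close> is the \<open>i\<close>-th new vertex of the \<open>j\<close>-th clique attached to \<open>u\<close> when passing
  from stage \<open>l - 1\<close> to stage \<open>l\<close>.  The stage is recorded in the name so that the vertices added
  at a stage are distinct from all earlier ones, whatever the parameters are.
\<close>

datatype vertex = Base nat | New nat vertex nat nat

definition new_clique :: "nat \<Rightarrow> nat \<Rightarrow> vertex \<Rightarrow> nat \<Rightarrow> vertex set" where
  "new_clique l n u j = insert u (New l u j ` {1..n - 1})"

definition attach_cliques :: "nat \<Rightarrow> nat \<Rightarrow> nat \<Rightarrow> vertex graph \<Rightarrow> vertex graph" where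
  "attach_cliques l n k G =
     \<lparr>verts = verts G \<union> (\<Union>u\<in>{u. simplicial G u}. \<Union>j\<in>{1..k - 1}. new_clique l n u j),
      edges = edges G \<union>
        (\<Union>u\<in>{u. simplicial G u}. \<Union>j\<in>{1..k - 1}. complete_edges (new_clique l n u j))\<rparr>"

text \<open>The argument \<open>l\<close> is meant to be at least 1; the value at 0 is arbitrary.\<close>

fun B :: "nat \<Rightarrow> nat \<Rightarrow> nat \<Rightarrow> vertex graph" where
  "B 0 n k = undefined"
| "B (Suc 0) n k = complete_graph (Base ` {1..n})"
| "B (Suc (Suc l)) n k = attach_cliques (Suc (Suc l)) n k (B (Suc l) n k)"

end

theory Submission
  imports Defs
begin

text \<open>
  Up to renaming colors, the graph has only one proper \<open>n\<close>-coloring: the new vertices of a clique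
  attached to \<open>u\<close> receive each color other than that of \<open>u\<close> once.  If each color occurs \<open>a\<close> times
  among the \<open>s\<close> simplicial vertices, then each color occurs \<open>(k - 1) * (s - a)\<close> times among the
  vertices added next, and these are exactly the new simplicial vertices.  So at every stage all
  color classes have the same size.
\<close>

section \<open>Complete sets, cliques and simplicial vertices\<close>

lemma doubleton_in_complete_edges:
  "{x, y} \<in> complete_edges S \<longleftrightarrow> x \<in> S \<and> y \<in> S \<and> x \<noteq> y"
  by (auto simp: complete_edges_def doubleton_eq_iff)

lemma complete_edges_subset_iff:
  "complete_edges S \<subseteq> E \<longleftrightarrow> (\<forall>x\<in>S. \<forall>y\<in>S. x \<noteq> y \<longrightarrow> {x, y} \<in> E)"
  by (auto simp: complete_edges_def)

lemma complete_edges_mono: "S \<subseteq> T \<Longrightarrow> complete_edges S \<subseteq> complete_edges T"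
  by (auto simp: complete_edges_def)

text \<open>The record type alone admits loops and edges leaving the vertex set. Finiteness ensures
  that complete sets extend to maximal ones.\<close>

definition wf_graph :: "'a graph \<Rightarrow> bool" where
  "wf_graph G \<longleftrightarrow> finite (verts G) \<and> edges G \<subseteq> complete_edges (verts G)"

lemma wf_graph_edge:
  assumes "wf_graph G" "{x, y} \<in> edges G"
  shows "x \<in> verts G" "y \<in> verts G" "x \<noteq> y"
  using assms doubleton_in_complete_edges[of x y "verts G"] by (auto simp: wf_graph_def)

lemma complete_in_extends_to_clique:
  assumes "finite (verts G)" "complete_in G S"
  obtains C where "clique G C" "S \<subseteq> C"
proof -
  let ?F = "{T. complete_in G T}"
  have "finite ?F"
    using assms(1) by (rule finite_subset[rotated, OF finite_Pow_iff[THEN iffD2]])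
      (auto simp: complete_in_def)
  then obtain C where "C \<in> ?F" "S \<subseteq> C" "\<forall>T\<in>?F. C \<subseteq> T \<longrightarrow> T = C"
    using finite_has_maximal2[of ?F S] assms(2) by (metis mem_Collect_eq)
  then have "clique G C"
    by (simp add: clique_def)
  then show ?thesis
    using that \<open>S \<subseteq> C\<close> by blast
qed

text \<open>Each edge at \<open>v\<close> extends to a clique. Only one clique contains
  \<open>v\<close>, so all neighbors of \<open>v\<close> lie in it together.\<close>

lemma simplicial_neighbors_adjacent:
  assumes "wf_graph G" "simplicial G v" "{v, x} \<in> edges G" "{v, y} \<in> edges G" "x \<noteq> y"
  shows "{x, y} \<in> edges G"
proof -
  have extend: "\<exists>C. clique G C \<and> v \<in> C \<and> z \<in> C" if "{v, z} \<in> edges G" for z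
  proof -
    have "complete_in G {v, z}"
      using that wf_graph_edge[OF assms(1) that]
      by (auto simp: complete_in_def complete_edges_subset_iff insert_commute)
    then obtain C where "clique G C" "{v, z} \<subseteq> C"
      using assms(1) complete_in_extends_to_clique unfolding wf_graph_def by blast
    then show ?thesis
      by blast
  qed
  obtain C where C: "clique G C" "v \<in> C" "x \<in> C" "y \<in> C"
    using extend[OF assms(3)] extend[OF assms(4)] assms(2) unfolding simplicial_def by metis
  then show ?thesis
    using assms(5) by (auto simp: clique_def complete_in_def complete_edges_subset_iff)
qed

text \<open>Every complete set through \<open>v\<close> consists of \<open>v\<close> and neighbors
  of \<open>v\<close>, hence lies in \<open>C\<close>; so \<open>C\<close> is the only maximal
  one.\<close>

lemma simplicialI:
  assumes "complete_in G C" "v \<in> C" "\<And>x. {v, x} \<in> edges G \<Longrightarrow> x \<in> C"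
  shows "simplicial G v"
proof -
  have sub: "S \<subseteq> C" if "complete_in G S" "v \<in> S" for S
    using that assms(2,3) unfolding complete_in_def complete_edges_subset_iff
    by (metis subsetI)
  then have "clique G C"
    using assms(1,2) unfolding clique_def by blast
  moreover have "D = C" if "clique G D" "v \<in> D" for D
    using that sub assms(1) unfolding clique_def by blast
  moreover have "v \<in> verts G"
    using assms(1,2) by (auto simp: complete_in_def)
  ultimately show ?thesis
    using assms(2) unfolding simplicial_def by blast
qed

text \<open>A proper coloring is injective on complete sets, so \<open>n\<close> colors bound their
  size by \<open>n\<close>, and \<open>C\<close> attains the bound.\<close>

lemma clique_number_eqI:
  assumes "wf_graph G" "proper_coloring G n c" "complete_in G C" "card C = n"
  shows "clique_number G = n"
proof -
  have fin: "finite S" if "complete_in G S" for S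
    using that assms(1) by (auto simp: complete_in_def wf_graph_def intro: finite_subset)
  have le: "card S \<le> n" if "complete_in G S" for S
  proof -
    have "inj_on c S" "c ` S \<subseteq> {1..n}"
      using that assms(2)
      unfolding complete_in_def proper_coloring_def complete_edges_subset_iff inj_on_def by blast+
    then show ?thesis
      using card_inj_on_le[of c S "{1..n}"] by simp
  qed
  have "clique G C"
    unfolding clique_def using assms(3,4) le fin by (metis card_seteq)
  then show ?thesis
    unfolding clique_number_def using le assms(4)
    by (intro Max_eqI) (auto simp: clique_def intro: finite_subset[of _ "{..n}"])
qed

section \<open>The coloring and its class sizes\<close>

text \<open>For fixed \<open>u\<close> and \<open>j\<close>, the indices \<open>1..n - 1\<close> run
  in increasing order through the colors in \<open>1..n\<close>, skipping that of
  \<open>u\<close>.\<close>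

fun col :: "vertex \<Rightarrow> nat" where
  "col (Base i) = i"
| "col (New l u j i) = (if i < col u then i else Suc i)"

text \<open>Stated for vertex sets rather than graphs, since the induction needs it for the
  simplicial vertices as well as for all vertices.\<close>

definition balanced :: "nat \<Rightarrow> vertex set \<Rightarrow> bool" where
  "balanced n X \<longleftrightarrow> (\<exists>a. \<forall>q\<in>{1..n}. card {v \<in> X. col v = q} = a)"

lemma balanced_Un:
  assumes "balanced n X" "balanced n Y" "X \<inter> Y = {}" "finite X" "finite Y"
  shows "balanced n (X \<union> Y)"
proof -
  have "{v \<in> X \<union> Y. col v = q} = {v \<in> X. col v = q} \<union> {v \<in> Y. col v = q}" for q
    by auto
  then have "card {v \<in> X \<union> Y. col v = q} =
      card {v \<in> X. col v = q} + card {v \<in> Y. col v = q}" for q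
    using assms(3-5) by (simp add: card_Un_disjoint disjoint_iff)
  then show ?thesis
    using assms(1,2) unfolding balanced_def by fastforce
qed

text \<open>The \<open>n\<close> classes partition the vertices, so a common size \<open>a\<close>
  makes the quotient the integer \<open>a\<close>, equal to its floor and ceiling.\<close>

lemma equitable_col_if_balanced:
  assumes "proper_coloring G n col" "balanced n (verts G)" "finite (verts G)" "n \<ge> 1"
  shows "equitable_coloring G n col"
proof -
  obtain a where a: "\<And>q. q \<in> {1..n} \<Longrightarrow> card {v \<in> verts G. col v = q} = a"
    using assms(2) by (auto simp: balanced_def)
  have "verts G = (\<Union>q\<in>{1..n}. {v \<in> verts G. col v = q})"
    using assms(1) by (auto simp: proper_coloring_def)
  also have "card \<dots> = (\<Sum>q\<in>{1..n}. card {v \<in> verts G. col v = q})"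
    using assms(3) by (intro card_UN_disjoint) auto
  also have "\<dots> = n * a"
    using a by simp
  finally have "real (card (verts G)) / real n = real a"
    using assms(4) by simp
  then show ?thesis
    using assms(1) a by (simp add: equitable_coloring_def)
qed

definition new_vertices :: "nat \<Rightarrow> nat \<Rightarrow> nat \<Rightarrow> vertex set \<Rightarrow> vertex set" where
  "new_vertices l n k U = {New l u j i | u j i. u \<in> U \<and> j \<in> {1..k - 1} \<and> i \<in> {1..n - 1}}"

lemma finite_new_vertices:
  assumes "finite U"
  shows "finite (new_vertices l n k U)"
proof -
  have "new_vertices l n k U = (\<lambda>(u, j, i). New l u j i) ` (U \<times> {1..k - 1} \<times> {1..n - 1})"
    unfolding new_vertices_def by (auto simp: image_iff)
  then show ?thesis
    using assms by simp
qed

text \<open>The vertex of color \<open>q\<close> in a clique attached to \<open>u\<close> has index \<open>q\<close> or \<open>q - 1\<close>.\<close>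

lemma card_new_vertices_col:
  assumes "finite U" "col ` U \<subseteq> {1..n}" "q \<in> {1..n}"
  shows "card {v \<in> new_vertices l n k U. col v = q} =
    (card U - card {u \<in> U. col u = q}) * (k - 1)"
proof -
  let ?W = "{u \<in> U. col u \<noteq> q}"
  let ?f = "\<lambda>(u, j). New l u j (if q < col u then q else q - 1)"
  have "{v \<in> new_vertices l n k U. col v = q} = ?f ` (?W \<times> {1..k - 1})" (is "?L = ?R")
  proof
    show "?L \<subseteq> ?R"
    proof
      fix v
      assume "v \<in> ?L"
      then obtain u j i where *: "v = New l u j i" "u \<in> U" "j \<in> {1..k - 1}" "col v = q"
        unfolding new_vertices_def by blast
      then have "col u \<noteq> q" "i = (if q < col u then q else q - 1)"
        by (auto split: if_splits)
      then show "v \<in> ?R"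
        using * by (intro image_eqI[of _ _ "(u, j)"]) auto
    qed
    show "?R \<subseteq> ?L"
    proof
      fix v
      assume "v \<in> ?R"
      then obtain u j where *: "v = New l u j (if q < col u then q else q - 1)"
        "u \<in> U" "col u \<noteq> q" "j \<in> {1..k - 1}"
        by auto
      \<comment> \<open>This keeps the index in range: \<open>q < col u\<close> gives
        \<open>q \<le> n - 1\<close>, and \<open>col u < q\<close> gives
        \<open>q - 1 \<ge> 1\<close>.\<close>
      moreover have "col u \<in> {1..n}"
        using * assms(2) by blast
      ultimately have "(if q < col u then q else q - 1) \<in> {1..n - 1}" "col v = q"
        using assms(3) by auto
      then show "v \<in> ?L"
        using * unfolding new_vertices_def by blast
    qed
  qed
  moreover have "inj_on ?f (?W \<times> {1..k - 1})"
    by (auto simp: inj_on_def)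
  ultimately have "card {v \<in> new_vertices l n k U. col v = q} = card ?W * (k - 1)"
    by (simp add: card_image card_cartesian_product)
  moreover have "?W = U - {u \<in> U. col u = q}"
    by auto
  ultimately show ?thesis
    using assms(1) by (simp add: card_Diff_subset)
qed

lemma balanced_new_vertices:
  assumes "finite U" "col ` U \<subseteq> {1..n}" "balanced n U"
  shows "balanced n (new_vertices l n k U)"
  using assms card_new_vertices_col[OF assms(1,2)] unfolding balanced_def by auto

section \<open>One attachment step\<close>

locale attachment =
  fixes G :: "vertex graph" and l n k :: nat
  assumes wf: "wf_graph G"
    and fresh: "New l u j i \<notin> verts G"
    and n: "n \<ge> 2" and k: "k \<ge> 3"
begin

abbreviation H :: "vertex graph" where
  "H \<equiv> attach_cliques l n k G"

abbreviation N :: "vertex set" where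
  "N \<equiv> new_vertices l n k {u. simplicial G u}"

lemma simplicial_subset: "{u. simplicial G u} \<subseteq> verts G"
  by (auto simp: simplicial_def)

lemma verts_H: "verts H = verts G \<union> N"
proof -
  have "(\<Union>u\<in>{u. simplicial G u}. \<Union>j\<in>{1..k - 1}. new_clique l n u j) \<union> verts G = verts G \<union> N"
    using simplicial_subset unfolding new_clique_def new_vertices_def by blast
  then show ?thesis
    by (simp add: attach_cliques_def Un_commute)
qed

lemma edges_H: "{x, y} \<in> edges H \<longleftrightarrow> {x, y} \<in> edges G \<or> x \<noteq> y \<and>
    (\<exists>u j. simplicial G u \<and> j \<in> {1..k - 1} \<and> x \<in> new_clique l n u j \<and> y \<in> new_clique l n u j)"
  by (simp only: attach_cliques_def graph.simps Un_iff UN_iff mem_Collect_eq bex_simps Bex_def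
      doubleton_in_complete_edges) blast

lemma wf_H: "wf_graph H"
proof -
  have sub: "new_clique l n u j \<subseteq> verts H" if "simplicial G u" "j \<in> {1..k - 1}" for u j
    using that by (auto simp: attach_cliques_def)
  have "finite (verts H)"
    using wf simplicial_subset
    by (auto simp: verts_H wf_graph_def intro!: finite_new_vertices intro: finite_subset)
  moreover have "edges G \<subseteq> complete_edges (verts H)"
    using wf complete_edges_mono[of "verts G" "verts H"] by (auto simp: verts_H wf_graph_def)
  moreover have "edges H = edges G \<union>
      (\<Union>u\<in>{u. simplicial G u}. \<Union>j\<in>{1..k - 1}. complete_edges (new_clique l n u j))"
    by (simp add: attach_cliques_def)
  ultimately show ?thesis
    using complete_edges_mono[OF sub] unfolding wf_graph_def by blast
qed

lemma disjoint_new: "verts G \<inter> N = {}"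
  using fresh by (auto simp: new_vertices_def)

text \<open>An attached clique meets \<open>verts G\<close> only in the vertex it is attached to, so
  it joins no two old vertices.\<close>

lemma edges_H_old:
  assumes "{x, y} \<in> edges H" "x \<in> verts G" "y \<in> verts G"
  shows "{x, y} \<in> edges G"
  using assms fresh by (auto simp: edges_H new_clique_def)

text \<open>The name of a new vertex determines \<open>u\<close> and \<open>j\<close>, so it lies in
  a single attached clique; by \<open>fresh\<close> it is on no edge of \<open>G\<close>.\<close>

lemma edges_H_new:
  assumes "{New l u j i, y} \<in> edges H"
  shows "y \<in> new_clique l n u j"
  using assms fresh simplicial_subset
  by (auto simp: edges_H new_clique_def dest: wf_graph_edge(1)[OF wf])

lemma simplicial_new:
  assumes "v \<in> N"
  shows "simplicial H v"
proof -
  obtain u j i where v: "v = New l u j i" "simplicial G u" "j \<in> {1..k - 1}" "i \<in> {1..n - 1}"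
    using assms by (auto simp: new_vertices_def)
  have "complete_in H (new_clique l n u j)"
    using v by (auto simp: complete_in_def attach_cliques_def)
  then show ?thesis
    by (rule simplicialI) (use v edges_H_new in \<open>auto simp: new_clique_def\<close>)
qed

text \<open>If \<open>v\<close> were simplicial in \<open>H\<close>, it would be so in
  \<open>G\<close>, since no edges between old vertices are added. Then several cliques were
  attached to \<open>v\<close>, and new vertices from two of them are nonadjacent neighbors of
  \<open>v\<close>.\<close>

lemma not_simplicial_old:
  assumes "v \<in> verts G"
  shows "\<not> simplicial H v"
proof
  assume H: "simplicial H v"
  have "simplicial G v"
  proof (rule simplicialI)
    \<comment> \<open>The complete set used is the closed neighborhood of \<open>v\<close> in
      \<open>G\<close>.\<close>
    show "v \<in> insert v {x. {v, x} \<in> edges G}"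
      by simp
    have "{x, y} \<in> edges G" if "{v, x} \<in> edges G" "{v, y} \<in> edges G" "x \<noteq> y" for x y
    proof (rule edges_H_old)
      show "{x, y} \<in> edges H"
        using simplicial_neighbors_adjacent[OF wf_H H] that by (simp add: edges_H)
    qed (use that wf_graph_edge[OF wf] in auto)
    then show "complete_in G (insert v {x. {v, x} \<in> edges G})"
      using assms wf_graph_edge(2)[OF wf]
      unfolding complete_in_def complete_edges_subset_iff
      by (auto simp: insert_commute[of _ v])
  qed simp
  then have "{v, New l v j 1} \<in> edges H" if "j \<in> {1..k - 1}" for j
    using that n assms fresh[of v j 1]
    by (auto simp: edges_H new_clique_def intro!: exI[of _ v] exI[of _ j])
  \<comment> \<open>Two attached cliques exist because \<open>k \<ge> 3\<close>, and each has a new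
    vertex of index 1 because \<open>n \<ge> 2\<close>.\<close>
  then have "{New l v 1 1, New l v 2 1} \<in> edges H"
    using simplicial_neighbors_adjacent[OF wf_H H] k by simp
  then have "New l v 2 1 \<in> new_clique l n v 1"
    by (rule edges_H_new)
  then show False
    using assms fresh by (auto simp: new_clique_def)
qed

lemma simplicial_H: "{v. simplicial H v} = N"
proof -
  have "{v. simplicial H v} \<subseteq> verts G \<union> N"
    unfolding verts_H[symmetric] by (auto simp: simplicial_def)
  then show ?thesis
    using simplicial_new not_simplicial_old by blast
qed

lemma proper_coloring_H:
  assumes "proper_coloring G n col"
  shows "proper_coloring H n col"
proof -
  have old: "col v \<in> {1..n}" if "v \<in> verts G" for v
    using that assms by (auto simp: proper_coloring_def)
  have "col v \<in> {1..n}" if "v \<in> N" for v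
    using that by (auto simp: new_vertices_def)
  \<comment> \<open>The color is strictly increasing in the index and never equals that of
    \<open>u\<close>.\<close>
  moreover have "inj_on col (new_clique l n u j)" for u j
    by (auto simp: new_clique_def inj_on_def split: if_splits)
  ultimately show ?thesis
    using assms old by (auto simp: proper_coloring_def edges_H verts_H dest: inj_onD)
qed

end

section \<open>Induction over the stages\<close>

text \<open>Provides \<open>fresh\<close> for the next stage, whose tag exceeds every tag already in
  use.\<close>

lemma fresh_B:
  assumes "l \<ge> 1" "New m u j i \<in> verts (B l n k)"
  shows "m \<le> l"
  using assms
proof (induction l n k rule: B.induct)
  case (3 l n k)
  then show ?case
    by (fastforce simp: attach_cliques_def new_clique_def simplicial_def)
qed (auto simp: complete_graph_def)

lemma simplicial_complete_graph: "{v. simplicial (complete_graph S) v} = S"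
proof -
  have "simplicial (complete_graph S) v" if "v \<in> S" for v
    by (rule simplicialI[where C = S])
      (use that in \<open>auto simp: complete_in_def complete_graph_def doubleton_in_complete_edges\<close>)
  moreover have "v \<in> S" if "simplicial (complete_graph S) v" for v
    using that by (simp add: simplicial_def complete_graph_def)
  ultimately show ?thesis
    by blast
qed

text \<open>Balance of the simplicial vertices drives the induction, because the next vertices are
  attached to them. The initial complete graph survives as a complete set of size \<open>n\<close>,
  which fixes the clique number.\<close>

lemma B_invariant:
  assumes "l \<ge> 1" "n \<ge> 2" "k \<ge> 3"
  shows "wf_graph (B l n k) \<and> proper_coloring (B l n k) n col \<and>
    complete_in (B l n k) (Base ` {1..n}) \<and>
    balanced n (verts (B l n k)) \<and> balanced n {v. simplicial (B l n k) v}"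
  using assms
proof (induction l n k rule: B.induct)
  case (1 n k)
  then show ?case
    by simp
next
  case (2 n k)
  have "{v \<in> Base ` {1..n}. col v = q} = {Base q}" if "q \<in> {1..n}" for q
    using that by auto
  then have "balanced n (Base ` {1..n})"
    unfolding balanced_def by (intro exI[of _ 1]) auto
  then show ?case
    unfolding B.simps simplicial_complete_graph
    by (auto simp: complete_graph_def wf_graph_def proper_coloring_def complete_in_def
        doubleton_in_complete_edges)
next
  case (3 l n k)
  let ?G = "B (Suc l) n k"
  have IH: "wf_graph ?G" "proper_coloring ?G n col" "complete_in ?G (Base ` {1..n})"
    "balanced n (verts ?G)" "balanced n {v. simplicial ?G v}"
    using 3 by auto
  have "New (Suc (Suc l)) u j i \<notin> verts ?G" for u j i
    using fresh_B[of "Suc l" "Suc (Suc l)"] by auto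
  then interpret attachment ?G "Suc (Suc l)" n k
    using IH(1) 3(3,4) by unfold_locales
  have fin: "finite (verts ?G)"
    using IH(1) by (simp add: wf_graph_def)
  have "finite {v. simplicial ?G v}" "col ` {v. simplicial ?G v} \<subseteq> {1..n}"
    using finite_subset[OF simplicial_subset fin] simplicial_subset IH(2)
    unfolding proper_coloring_def by blast+
  \<comment> \<open>\<open>N\<close> is both the set of added vertices and the set of simplicial
    vertices of \<open>H\<close>, so its balance serves both balance claims.\<close>
  then have "balanced n N" "finite N"
    using IH(5) balanced_new_vertices finite_new_vertices by auto
  moreover from this have "balanced n (verts H)"
    using IH(4) disjoint_new fin unfolding verts_H by (intro balanced_Un)
  moreover have "complete_in H (Base ` {1..n})"
    using IH(3) by (auto simp: complete_in_def attach_cliques_def)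
  ultimately show ?case
    using wf_H proper_coloring_H[OF IH(2)] by (simp add: simplicial_H)
qed

theorem theorem4:
  fixes l n k :: nat
  assumes "l \<ge> 1" and "n \<ge> 2" and "k \<ge> 3"
  shows "\<exists>c. equitable_coloring (B l n k) (clique_number (B l n k)) c"
proof -
  have "clique_number (B l n k) = n"
    using B_invariant[OF assms] by (intro clique_number_eqI[where C = "Base ` {1..n}"])
      (auto simp: card_image inj_on_def)
  moreover have "equitable_coloring (B l n k) n col"
    using B_invariant[OF assms] assms(2)
    by (intro equitable_col_if_balanced) (auto simp: wf_graph_def)
  ultimately show ?thesis
    by auto
qed

end
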